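(* Let $\rho\ge1$ be real. Every knapsack system $(S,\mathcal{I})$ with ratio bound $\rho$ is a $\lceil\rho\rceil$-growth system.
   Context: Knapsack system: $S$ is a finite (nonempty) set, $s:S\to\mathbb{R}_{\ge0}$, and $\mathcal{I}=\{I\subseteq S:\sum_{e\in I}s(e)\le1\}$. It has ratio bound $\rho$ if $\max_{e\in S}s(e)=\rho\cdot\min_{e\in S}s(e)$. $k$-growth system ($k$ a positive integer): an independence system $(S,\mathcal{I})$ (finite $S$, nonempty downward-closed $\mathcal{I}\subseteq2^S$) such that for all $X\subseteq S$ and all $I\in\mathcal{I}$ there is a partition $(Q,Z)$ of $I\setminus X$ with $|Z|\le k|X\setminus I|$ such that $P\cup Q\in\mathcal{I}$ for every basis $P$ of $X$, where a basis of $X$ is an inclusion-wise maximal independent subset of $X$. *)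

theory Defs
  imports Complex_Main
begin

definition independence_system :: "'a set \<Rightarrow> 'a set set \<Rightarrow> bool" where
  "independence_system S \<I> \<longleftrightarrow>
     finite S \<and> \<I> \<subseteq> Pow S \<and> \<I> \<noteq> {} \<and> (\<forall>I\<in>\<I>. \<forall>J. J \<subseteq> I \<longrightarrow> J \<in> \<I>)"

definition basis_of :: "'a set set \<Rightarrow> 'a set \<Rightarrow> 'a set \<Rightarrow> bool" where
  "basis_of \<I> X P \<longleftrightarrow>
     P \<subseteq> X \<and> P \<in> \<I> \<and> (\<forall>P'. P \<subseteq> P' \<and> P' \<subseteq> X \<and> P' \<in> \<I> \<longrightarrow> P' = P)"

(* The parts Q and Z of the partition may be empty, and they are chosen before the basis P. *)
definition growth_system :: "nat \<Rightarrow> 'a set \<Rightarrow> 'a set set \<Rightarrow> bool" where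
  "growth_system k S \<I> \<longleftrightarrow>
     k > 0 \<and> independence_system S \<I> \<and>
     (\<forall>X I. X \<subseteq> S \<and> I \<in> \<I> \<longrightarrow>
        (\<exists>Q Z. Q \<union> Z = I - X \<and> Q \<inter> Z = {} \<and> card Z \<le> k * card (X - I) \<and>
               (\<forall>P. basis_of \<I> X P \<longrightarrow> P \<union> Q \<in> \<I>)))"

(* The size function s is only constrained on S; its values elsewhere are irrelevant. *)
definition knapsack_system :: "'a set \<Rightarrow> ('a \<Rightarrow> real) \<Rightarrow> 'a set set \<Rightarrow> bool" where
  "knapsack_system S s \<I> \<longleftrightarrow>
     finite S \<and> S \<noteq> {} \<and> (\<forall>e\<in>S. 0 \<le> s e) \<and> \<I> = {I. I \<subseteq> S \<and> (\<Sum>e\<in>I. s e) \<le> 1}"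

definition has_ratio_bound :: "'a set \<Rightarrow> ('a \<Rightarrow> real) \<Rightarrow> real \<Rightarrow> bool" where
  "has_ratio_bound S s \<rho> \<longleftrightarrow> Max (s ` S) = \<rho> * Min (s ` S)"

end

theory Submission
  imports Defs
begin

text \<open>
  Put \<open>k = \<lceil>\<rho>\<rceil>\<close>. An element of \<open>S\<close> is at most \<open>\<rho>\<close> times as large as any other, so \<open>k * card (X - I)\<close>
  elements of \<open>I - X\<close> are together at least as large as \<open>X - I\<close>. If \<open>I - X\<close> has that many elements,
  exchanging them for \<open>X - I\<close> turns \<open>I\<close> into \<open>X \<union> Q\<close>, which is then independent and contains
  \<open>P \<union> Q\<close> for every \<open>P \<subseteq> X\<close>. Otherwise all of \<open>I - X\<close> can be given up.
\<close>

lemma knapsack_independence_system: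
  assumes "knapsack_system S s \<I>"
  shows "independence_system S \<I>"
proof -
  have fin: "finite S" and nonneg: "\<forall>e\<in>S. 0 \<le> s e"
    and \<I>: "\<I> = {I. I \<subseteq> S \<and> sum s I \<le> 1}"
    using assms by (auto simp: knapsack_system_def)
  have "J \<in> \<I>" if "I \<in> \<I>" "J \<subseteq> I" for I J
  proof -
    have "sum s J \<le> sum s I"
      using that fin nonneg \<I> by (intro sum_mono2) (auto intro: finite_subset)
    with that show ?thesis
      using \<I> by auto
  qed
  moreover have "{} \<in> \<I>"
    using \<I> by simp
  ultimately show ?thesis
    using fin \<I> unfolding independence_system_def by blast
qed

text \<open>With \<open>m\<close> the least size, all sizes on \<open>S\<close> lie between
  \<open>m\<close> and \<open>k * m\<close>. Both sums can thus be compared with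
  \<open>card A * (k * m)\<close>, which equals \<open>card B * m\<close>: it bounds
  \<open>sum s A\<close> from above and \<open>sum s B\<close> from below.\<close>

lemma sum_le_sum_of_ratio_bound:
  assumes "knapsack_system S s \<I>" and "has_ratio_bound S s \<rho>"
    and "\<rho> \<le> real k" and "A \<subseteq> S" and "B \<subseteq> S" and "card B = k * card A"
  shows "sum s A \<le> sum s B"
proof -
  define m where "m = Min (s ` S)"
  have fin: "finite S" and ne: "S \<noteq> {}" and nonneg: "\<forall>e\<in>S. 0 \<le> s e"
    using assms(1) by (auto simp: knapsack_system_def)
  have m: "0 \<le> m" "\<And>e. e \<in> S \<Longrightarrow> m \<le> s e"
    using fin ne nonneg by (auto simp: m_def)
  have "s e \<le> real k * m" if "e \<in> S" for e
  proof -
    have "s e \<le> \<rho> * m"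
      using assms(2) fin that by (metis Max_ge finite_imageI has_ratio_bound_def image_eqI m_def)
    also have "\<dots> \<le> real k * m"
      using assms(3) m(1) by (rule mult_right_mono)
    finally show ?thesis .
  qed
  then have "sum s A \<le> real (card A) * (real k * m)"
    using assms(4) by (intro sum_bounded_above) auto
  also have "\<dots> = real (card B) * m"
    using assms(6) by simp
  also have "\<dots> \<le> sum s B"
    using assms(5) m(2) by (intro sum_bounded_below) auto
  finally show ?thesis .
qed

theorem theorem14:
  fixes \<rho> :: real and S :: "'a set" and s :: "'a \<Rightarrow> real" and \<I> :: "'a set set"
  assumes "\<rho> \<ge> 1"
    and "knapsack_system S s \<I>"
    and "has_ratio_bound S s \<rho>"
  shows "growth_system (nat \<lceil>\<rho>\<rceil>) S \<I>"
proof -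
  define k where "k = nat \<lceil>\<rho>\<rceil>"
  have k: "k > 0" "\<rho> \<le> real k"
    using assms(1) unfolding k_def by linarith+
  have indep: "independence_system S \<I>"
    using assms(2) by (rule knapsack_independence_system)
  have fin: "finite S" and \<I>: "\<I> = {I. I \<subseteq> S \<and> sum s I \<le> 1}"
    using assms(2) by (auto simp: knapsack_system_def)
  have "\<exists>Q Z. Q \<union> Z = I - X \<and> Q \<inter> Z = {} \<and> card Z \<le> k * card (X - I) \<and>
          (\<forall>P. basis_of \<I> X P \<longrightarrow> P \<union> Q \<in> \<I>)"
    if X: "X \<subseteq> S" and I: "I \<in> \<I>" for X I
  proof (cases "card (I - X) \<le> k * card (X - I)")
    case True
    \<comment> \<open>With \<open>Q\<close> empty, \<open>P \<union> Q\<close> is the basis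
      \<open>P\<close> itself and hence independent.\<close>
    then show ?thesis
      by (intro exI[of _ "{}"] exI[of _ "I - X"]) (auto simp: basis_of_def)
  next
    case False
    \<comment> \<open>\<open>Z\<close> gets the largest size that the growth condition permits,
      which is also the size at which it is sure to weigh at least as much as
      \<open>X - I\<close>.\<close>
    then obtain Z where Z: "Z \<subseteq> I - X" "card Z = k * card (X - I)"
      by (meson nat_le_linear obtain_subset_with_card_n)
    have IS: "I \<subseteq> S" and I1: "sum s I \<le> 1"
      using I \<I> by auto
    have finX: "finite X" and finI: "finite I"
      using X IS fin by (auto intro: finite_subset)
    let ?Q = "I - X - Z"
    have "sum s (X \<union> ?Q) = sum s (X - I) + sum s (I - Z)"
    proof -
      have "X \<union> ?Q = (X - I) \<union> (I - Z)"
        using Z(1) by auto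
      then show ?thesis
        using finX finI by (simp add: sum.union_disjoint Int_Diff Diff_Int_distrib2 disjoint_iff)
    qed
    also have "\<dots> \<le> sum s Z + sum s (I - Z)"
      using sum_le_sum_of_ratio_bound[OF assms(2,3) k(2), of "X - I" Z] X IS Z by auto
    also have "\<dots> = sum s I"
      using Z(1) finI by (metis Diff_subset add.commute order_trans sum.subset_diff)
    \<comment> \<open>This set does not depend on \<open>P\<close>, so one choice of
      \<open>Q\<close> serves all bases of \<open>X\<close> by downward closure.\<close>
    finally have XQ: "X \<union> ?Q \<in> \<I>"
      using X IS I1 \<I> by auto
    have "P \<union> ?Q \<in> \<I>" if "basis_of \<I> X P" for P
    proof -
      have "P \<union> ?Q \<subseteq> X \<union> ?Q"
        using that by (auto simp: basis_of_def)
      with XQ indep show ?thesis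
        unfolding independence_system_def by blast
    qed
    with Z show ?thesis
      by (intro exI[of _ ?Q] exI[of _ Z]) auto
  qed
  with k(1) indep show ?thesis
    unfolding growth_system_def k_def by blast
qed

end
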